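(* For all real $c\ge 1$, $K\ge 1$ and $t>0$, $$\log\big(1+2c\max\{t^K,t^{1/K}\}\big)\le K^{1+c}\max\big\{\log(1+2ct),\,\big(\log(1+2ct)\big)^{1/K}\big\}.$$
   Context: $\log$ denotes the natural logarithm. *)

theory Defs
  imports Complex_Main
begin

end

theory Submission
  imports Defs "HOL-Analysis.Convex"
begin

text \<open>
  The two entries of the maximum on the left are bounded separately, each for every \<open>t > 0\<close>.
  Write \<open>u = 2 c t\<close>, \<open>L = ln (1 + u)\<close> and \<open>a = 1 / K\<close>.

  For \<open>t powr K\<close>: since \<open>2 c \<ge> 1\<close>, \<open>2 c t powr K \<le> u powr K\<close>, and superadditivity of
  \<open>x powr K\<close> (lemma \<open>ln_one_plus_powr_le\<close>) costs only a factor \<open>K \<le> K powr (1 + c)\<close>.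

  For \<open>t powr a\<close>: here \<open>2 c t powr a = (2 c) powr (1 - a) * u powr a\<close>, and Bernoulli's
  inequality in logarithmic form (lemma \<open>ln_one_plus_mult_le\<close>) moves the factor
  \<open>(2 c) powr (1 - a) \<ge> 1\<close> outside the logarithm.  What remains is free of \<open>c\<close>:
  \<open>ln (1 + u powr a) \<le> max L (L powr a)\<close> (lemma \<open>ln_one_plus_root_le\<close>).  The factor moved outside
  is at most \<open>K powr (1 + c)\<close>, because \<open>1 - 1 / K \<le> ln K\<close> while \<open>ln (2 c)\<close> is below \<open>1 + c\<close>
  (lemma \<open>powr_one_minus_inverse_le\<close>).
\<close>

text \<open>Bernoulli's inequality \<open>1 + m x \<le> (1 + x) powr m\<close> after taking logarithms.  It holds
  because \<open>1 + x\<close> is the convex combination of \<open>1 + m x\<close> and \<open>1\<close> with weights \<open>1 / m\<close> and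
  \<open>1 - 1 / m\<close>, and \<open>ln\<close> is concave with \<open>ln 1 = 0\<close>.\<close>

lemma ln_one_plus_mult_le:
  fixes m x :: real
  assumes "m \<ge> 1" and "x \<ge> 0"
  shows "ln (1 + m * x) \<le> m * ln (1 + x)"
proof -
  have pos: "1 + m * x > 0"
    using assms by (simp add: add_pos_nonneg)
  have comb: "(1 / m) * (1 + m * x) + (1 - 1 / m) * 1 = 1 + x"
    using assms by (simp add: field_simps)
  have concave: "p * ln y + q * ln z \<le> ln (p * y + q * z)"
    if "y > 0" "z > 0" "p \<ge> 0" "q \<ge> 0" "p + q = 1" for p q y z :: real
    using ln_concave that unfolding concave_on_iff by auto
  have "(1 / m) * ln (1 + m * x) + (1 - 1 / m) * ln 1
      \<le> ln ((1 / m) * (1 + m * x) + (1 - 1 / m) * 1)"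
    by (rule concave) (use assms pos in auto)
  then have "ln (1 + m * x) / m \<le> ln (1 + x)"
    unfolding comb by simp
  then show ?thesis
    using assms by (simp add: field_simps)
qed

text \<open>Superadditivity of \<open>x powr K\<close>: split one factor off
  \<open>(1 + u) powr K = (1 + u) * (1 + u) powr (K - 1)\<close>, expand it, and bound the remaining power
  below by \<open>1\<close> in one summand and by \<open>u powr (K - 1)\<close> in the other.\<close>

lemma ln_one_plus_powr_le:
  fixes K u :: real
  assumes "K \<ge> 1" and "u > 0"
  shows "ln (1 + u powr K) \<le> K * ln (1 + u)"
proof -
  have "u powr K = u * u powr (K - 1)"
    using assms by (simp add: powr_mult_base)
  also have "\<dots> \<le> u * (1 + u) powr (K - 1)"
    using assms by (intro mult_left_mono powr_mono2) auto
  finally have "u powr K \<le> u * (1 + u) powr (K - 1)" .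
  moreover have "1 \<le> (1 + u) powr (K - 1)"
    using assms by (intro ge_one_powr_ge_zero) auto
  ultimately have "1 + u powr K \<le> (1 + u) * (1 + u) powr (K - 1)"
    by (simp add: distrib_right)
  also have "\<dots> = (1 + u) powr K"
    using assms by (simp add: powr_mult_base)
  finally have "ln (1 + u powr K) \<le> ln ((1 + u) powr K)"
    by (intro ln_mono) (auto simp: add_pos_nonneg)
  then show ?thesis
    by simp
qed

text \<open>For \<open>u \<ge> 1\<close> the first entry of the maximum suffices by monotonicity.  For \<open>u \<le> 1\<close> the
  point is that \<open>ln (1 + x) / x\<close> decreases in \<open>x\<close> (Bernoulli again) and is at most \<open>1\<close>, while
  \<open>u \<le> u powr a\<close>; hence
  \<open>ln (1 + u powr a) \<le> u powr a * (ln (1 + u) / u) \<le> u powr a * (ln (1 + u) / u) powr a\<close>.\<close>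

lemma ln_one_plus_root_le:
  fixes a u :: real
  assumes "0 \<le> a" and "a \<le> 1" and "u > 0"
  shows "ln (1 + u powr a) \<le> max (ln (1 + u)) (ln (1 + u) powr a)"
proof (cases "u \<ge> 1")
  case True
  then have "u powr a \<le> u powr 1"
    using assms by (intro powr_mono) auto
  then have "ln (1 + u powr a) \<le> ln (1 + u)"
    using assms by (intro ln_mono) (auto simp: add_pos_nonneg)
  then show ?thesis
    by simp
next
  case False
  have Lpos: "ln (1 + u) > 0"
    using assms by simp
  have "u powr 1 \<le> u powr a"
    using assms False by (intro powr_mono') auto
  then have "u powr a / u \<ge> 1"
    using assms by simp
  then have "ln (1 + (u powr a / u) * u) \<le> (u powr a / u) * ln (1 + u)"
    using assms by (intro ln_one_plus_mult_le) auto
  then have "ln (1 + u powr a) \<le> u powr a * (ln (1 + u) / u) powr 1"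
    using assms Lpos by simp
  also have "\<dots> \<le> u powr a * (ln (1 + u) / u) powr a"
    using assms Lpos ln_add_one_self_le_self[of u]
    by (intro mult_left_mono powr_mono') auto
  also have "\<dots> = ln (1 + u) powr a"
    using assms by (simp add: powr_divide)
  finally show ?thesis
    by simp
qed

text \<open>Compare logarithms: \<open>1 - 1 / K \<le> ln K\<close> and \<open>ln (2 c) = ln 2 + ln c \<le> 1 + (c - 1)\<close>, so
  the logarithm \<open>(1 - 1 / K) * ln (2 c)\<close> of the left side is at most \<open>(1 + c) * ln K\<close>.\<close>

lemma powr_one_minus_inverse_le:
  fixes c K :: real
  assumes "c \<ge> 1" and "K \<ge> 1"
  shows "(2 * c) powr (1 - 1 / K) \<le> K powr (1 + c)"
proof -
  have "1 - 1 / K \<le> ln K"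
    using assms ln_le_minus_one[of "1 / K"] by (simp add: ln_div)
  moreover have "ln (2 * c) \<le> 1 + c"
    using assms ln_le_minus_one[of c] ln_le_minus_one[of 2] by (simp add: ln_mult)
  moreover have "0 \<le> ln (2 * c)" "0 \<le> ln K"
    using assms by auto
  ultimately have "(1 - 1 / K) * ln (2 * c) \<le> ln K * (1 + c)"
    by (intro mult_mono)
  then show ?thesis
    using assms by (simp add: powr_def mult.commute)
qed

theorem theorem3p1:
  fixes c K t :: real
  assumes "c \<ge> 1" and "K \<ge> 1" and "t > 0"
  shows "ln (1 + 2 * c * max (t powr K) (t powr (1 / K)))
    \<le> K powr (1 + c) * max (ln (1 + 2 * c * t)) (ln (1 + 2 * c * t) powr (1 / K))"
proof -
  define a u where "a = 1 / K" and "u = 2 * c * t"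
  define M where "M = max (ln (1 + u)) (ln (1 + u) powr a)"
  have u: "u > 0" and a: "0 \<le> a" "a \<le> 1"
    using assms by (auto simp: u_def a_def)
  have L: "0 \<le> ln (1 + u)" "ln (1 + u) \<le> M"
    using u by (auto simp: M_def)
  have power: "ln (1 + 2 * c * t powr K) \<le> K powr (1 + c) * M"
  proof -
    have "(2 * c) powr 1 \<le> (2 * c) powr K"
      using assms by (intro powr_mono) auto
    then have "2 * c * t powr K \<le> u powr K"
      using assms by (simp add: u_def powr_mult mult_right_mono)
    then have "ln (1 + 2 * c * t powr K) \<le> ln (1 + u powr K)"
      using assms by (intro ln_mono) (auto simp: add_pos_nonneg)
    also have "\<dots> \<le> K * ln (1 + u)"
      using assms u by (intro ln_one_plus_powr_le)
    also have "\<dots> \<le> K powr (1 + c) * M"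
      using assms L powr_mono[of 1 "1 + c" K] by (intro mult_mono) auto
    finally show ?thesis .
  qed
  have root: "ln (1 + 2 * c * t powr a) \<le> K powr (1 + c) * M"
  proof -
    define m where "m = (2 * c) powr (1 - a)"
    have m: "1 \<le> m" "m \<le> K powr (1 + c)"
      using assms a powr_one_minus_inverse_le[of c K] ge_one_powr_ge_zero[of "2 * c" "1 - a"]
      by (auto simp: m_def a_def)
    have "m * u powr a = ((2 * c) powr (1 - a) * (2 * c) powr a) * t powr a"
      by (simp add: m_def u_def powr_mult)
    also have "\<dots> = 2 * c * t powr a"
      using assms by (simp flip: powr_add)
    finally have "ln (1 + 2 * c * t powr a) = ln (1 + m * u powr a)"
      by simp
    also have "\<dots> \<le> m * ln (1 + u powr a)"
      using m by (intro ln_one_plus_mult_le) auto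
    also have "\<dots> \<le> K powr (1 + c) * M"
      using m ln_one_plus_root_le[OF a u] by (intro mult_mono) (auto simp: M_def)
    finally show ?thesis .
  qed
  have "ln (1 + 2 * c * max (t powr K) (t powr a)) \<le> K powr (1 + c) * M"
    using power root by (simp add: max_def)
  then show ?thesis
    by (simp add: M_def u_def a_def)
qed

end
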